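(* Let $G = \langle a_1, a_2,\ldots \mid r_1, r_2,\ldots \rangle$ be any countable group given by generators and defining relations. For each $s$ let $r'_s(x,y)\in F_2=\langle x,y\rangle$ be the word obtained from $r_s$ by replacing every generator $a_i$ occurring in $r_s$ by the word $$a_i(x,y) = y^{(x y^i)^{2}\, x^{-1}}\, y^{-x}.$$ Then the map $\gamma: a_i \mapsto a_i(x,y)$, $i=1,2,\ldots$, defines an injective embedding (injective group homomorphism) of $G$ into the $2$-generator group $$T_G=\big\langle x,y \;\mid\; r'_1(x,y),\; r'_2(x,y),\ldots \big\rangle$$ given by its relations $r'_s(x,y)$, $s=1,2,\ldots$
   Context: Conjugation notation: $u^v = v^{-1}uv$ and $u^{-v} = (u^{-1})^v = v^{-1}u^{-1}v$. $F_2=\langle x,y\rangle$ is the free group of rank $2$ on $x,y$. Thus, for $i=1,2,\ldots$, $a_i(x,y) = w_i^{-1}\, y\, w_i \cdot x^{-1}y^{-1}x$ with $w_i = (xy^i)^2x^{-1} = x y^i x y^i x^{-1}$. Each relation $r_s$ is a group word $r_s(a_{i_{s,1}},\ldots,a_{i_{s,k_s}})$ in finitely many of the letters $a_1,a_2,\ldots$ and their inverses, and $r'_s(x,y)= r_s\big(a_{i_{s,1}}(x,y),\ldots,a_{i_{s,k_s}}(x,y)\big)\in F_2$ (with $a_i^{-1}$ replaced by $a_i(x,y)^{-1}$). The presentation has countably many generators $a_1,a_2,\ldots$ and countably many relations $r_1,r_2,\ldots$ *)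

theory Defs
  imports "HOL-Algebra.Coset" "HOL-Algebra.Generated_Groups"
begin

section \<open>Group words\<close>

text \<open>The letter \<open>(a, True)\<close> stands for the generator \<open>a\<close> and
  \<open>(a, False)\<close> for its formal inverse. Words need not be reduced.\<close>

type_synonym 'a letter = "'a \<times> bool"
type_synonym 'a word = "'a letter list"

definition words :: "'a set \<Rightarrow> 'a word set" where
  "words A = lists (A \<times> UNIV)"

definition inv_letter :: "'a letter \<Rightarrow> 'a letter" where
  "inv_letter l = (fst l, \<not> snd l)"

definition inv_word :: "'a word \<Rightarrow> 'a word" where
  "inv_word w = rev (map inv_letter w)"

definition pow_word :: "'a word \<Rightarrow> nat \<Rightarrow> 'a word" where
  "pow_word w n = concat (replicate n w)"

definition conj_word :: "'a word \<Rightarrow> 'a word \<Rightarrow> 'a word" where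
  "conj_word u v = inv_word v @ u @ v"

definition subst_word :: "('a \<Rightarrow> 'b word) \<Rightarrow> 'a word \<Rightarrow> 'b word" where
  "subst_word f w = concat (map (\<lambda>(a, b). if b then f a else inv_word (f a)) w)"


section \<open>Free groups\<close>

definition reduced :: "'a word \<Rightarrow> bool" where
  "reduced w \<longleftrightarrow> successively (\<lambda>l m. m \<noteq> inv_letter l) w"

definition cancel_cons :: "'a letter \<Rightarrow> 'a word \<Rightarrow> 'a word" where
  "cancel_cons l w =
     (case w of [] \<Rightarrow> [l] | m # w' \<Rightarrow> if m = inv_letter l then w' else l # w)"

definition reduce :: "'a word \<Rightarrow> 'a word" where
  "reduce w = foldr cancel_cons w []"

definition free_group :: "'a set \<Rightarrow> 'a word monoid" where
  "free_group A =
     \<lparr> carrier = {w \<in> words A. reduced w}, monoid.mult = (\<lambda>u v. reduce (u @ v)), one = [] \<rparr>"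


section \<open>Presentations\<close>

definition normal_closure :: "('g, 'm) monoid_scheme \<Rightarrow> 'g set \<Rightarrow> 'g set" where
  "normal_closure G S = \<Inter> {N. N \<lhd> G \<and> S \<subseteq> N}"

definition relator_subgroup :: "'a set \<Rightarrow> 'a word set \<Rightarrow> 'a word set" where
  "relator_subgroup A R = normal_closure (free_group A) (reduce ` R)"

definition presented_group :: "'a set \<Rightarrow> 'a word set \<Rightarrow> 'a word set monoid" where
  "presented_group A R = free_group A Mod relator_subgroup A R"

text \<open>The element of the group presented by \<open>A\<close> and \<open>R\<close> that a word over \<open>A\<close> represents.\<close>

definition word_class :: "'a set \<Rightarrow> 'a word set \<Rightarrow> 'a word \<Rightarrow> 'a word set" where
  "word_class A R w = relator_subgroup A R #>\<^bsub>free_group A\<^esub> reduce w"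


section \<open>The universal words in the free group of rank two\<close>

datatype xy = Gen_x | Gen_y

abbreviation x_word :: "xy word" where "x_word \<equiv> [(Gen_x, True)]"
abbreviation y_word :: "xy word" where "y_word \<equiv> [(Gen_y, True)]"

text \<open>Here \<open>u\<^sup>v = v\<^sup>-\<^sup>1 u v\<close> and \<open>u\<^sup>-\<^sup>v = (u\<^sup>-\<^sup>1)\<^sup>v\<close>, so that the word below is
  \<open>y\<close> conjugated by \<open>(x y\<^sup>i)\<^sup>2 x\<^sup>-\<^sup>1\<close>, followed by \<open>y\<^sup>-\<^sup>1\<close> conjugated by \<open>x\<close>.\<close>

definition a_word :: "nat \<Rightarrow> xy word" where
  "a_word i =
     conj_word y_word (pow_word (x_word @ pow_word y_word i) 2 @ inv_word x_word) @
     conj_word (inv_word y_word) x_word"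


section \<open>Free groups and presented groups are groups\<close>

lemma inv_letter_simps [simp]:
  "inv_letter (inv_letter l) = l" "inv_letter l \<noteq> l" "l \<noteq> inv_letter l"
  "fst (inv_letter l) = fst l"
  by (auto simp: inv_letter_def prod_eq_iff)

lemma reduced_Nil [simp]: "reduced []"
  by (simp add: reduced_def)

lemma reduced_Cons:
  "reduced (l # w) \<longleftrightarrow> reduced w \<and> (w = [] \<or> hd w \<noteq> inv_letter l)"
  by (cases w) (auto simp: reduced_def)

lemma reduced_cancel_cons: "reduced w \<Longrightarrow> reduced (cancel_cons l w)"
  by (auto simp: cancel_cons_def reduced_Cons split: list.splits)

lemma reduced_foldr: "reduced v \<Longrightarrow> reduced (foldr cancel_cons u v)"
  by (induction u) (auto intro: reduced_cancel_cons)

lemma reduced_reduce [simp]: "reduced (reduce w)"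
  by (simp add: reduce_def reduced_foldr)

lemma reduce_reduced [simp]: "reduced w \<Longrightarrow> reduce w = w"
  by (induction w)
    (auto simp: reduce_def reduced_Cons cancel_cons_def split: list.splits)

lemma cancel_cons_inverse:
  "reduced w \<Longrightarrow> cancel_cons l (cancel_cons (inv_letter l) w) = w"
  by (auto simp: cancel_cons_def reduced_Cons split: list.splits)

lemma foldr_cancel_cons:
  assumes "reduced v"
  shows "foldr cancel_cons (cancel_cons l u) v = cancel_cons l (foldr cancel_cons u v)"
proof (cases u)
  case Nil
  then show ?thesis by (simp add: cancel_cons_def)
next
  case (Cons m u')
  then show ?thesis
    using cancel_cons_inverse [OF reduced_foldr [OF assms], of l u']
    by (auto simp: cancel_cons_def [of l "m # u'"])
qed

lemma foldr_reduce:
  "reduced v \<Longrightarrow> foldr cancel_cons (reduce u) v = foldr cancel_cons u v"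
  by (induction u) (auto simp: reduce_def foldr_cancel_cons)

lemma reduce_append: "reduce (u @ v) = foldr cancel_cons u (reduce v)"
  by (simp add: reduce_def)

lemma reduce_append_left [simp]: "reduce (reduce u @ v) = reduce (u @ v)"
  by (simp add: reduce_append foldr_reduce)

lemma reduce_append_right [simp]: "reduce (u @ reduce v) = reduce (u @ v)"
  by (simp add: reduce_append)

lemma reduce_inv_word_append [simp]: "reduce (inv_word w @ w) = []"
proof (induction w)
  case Nil
  then show ?case by (simp add: inv_word_def)
next
  case (Cons l w)
  have "reduce (inv_word (l # w) @ l # w)
      = foldr cancel_cons (inv_word w) (cancel_cons (inv_letter l) (cancel_cons l (reduce w)))"
    by (simp add: inv_word_def reduce_def)
  also have "\<dots> = reduce (inv_word w @ w)"
    using cancel_cons_inverse [of "reduce w" "inv_letter l"] by (simp add: reduce_append)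
  finally show ?case using Cons by simp
qed

lemma words_append [simp]: "u @ v \<in> words A \<longleftrightarrow> u \<in> words A \<and> v \<in> words A"
  by (auto simp: words_def)

lemma words_cancel_cons: "fst l \<in> A \<Longrightarrow> w \<in> words A \<Longrightarrow> cancel_cons l w \<in> words A"
  by (cases l) (auto simp: words_def cancel_cons_def split: list.splits)

lemma words_reduce: "w \<in> words A \<Longrightarrow> reduce w \<in> words A"
proof (induction w)
  case (Cons l w)
  then have "fst l \<in> A" "reduce w \<in> words A" by (auto simp: words_def)
  then show ?case
    using words_cancel_cons [of l A "reduce w"] by (simp add: reduce_def)
qed (simp add: reduce_def)

lemma words_inv_word: "w \<in> words A \<Longrightarrow> inv_word w \<in> words A"
  by (force simp: words_def inv_word_def inv_letter_def)

lemma reduce_in_free_group: "w \<in> words A \<Longrightarrow> reduce w \<in> carrier (free_group A)"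
  by (simp add: free_group_def words_reduce)

lemma group_free_group: "group (free_group A)"
proof (rule groupI)
  fix u assume u: "u \<in> carrier (free_group A)"
  show "\<exists>v\<in>carrier (free_group A). v \<otimes>\<^bsub>free_group A\<^esub> u = \<one>\<^bsub>free_group A\<^esub>"
  proof
    show "reduce (inv_word u) \<in> carrier (free_group A)"
      using u by (intro reduce_in_free_group words_inv_word) (simp add: free_group_def)
    show "reduce (inv_word u) \<otimes>\<^bsub>free_group A\<^esub> u = \<one>\<^bsub>free_group A\<^esub>"
      by (simp add: free_group_def)
  qed
qed (simp_all add: free_group_def words_reduce, simp add: words_def)

lemma normal_normal_closure:
  assumes "group G" "S \<subseteq> carrier G"
  shows "normal_closure G S \<lhd> G"
proof -
  interpret group G by fact
  let ?\<N> = "{N. N \<lhd> G \<and> S \<subseteq> N}"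
  have "carrier G \<lhd> G"
    by (rule normal_invI [OF subgroup_self]) auto
  then have ne: "carrier G \<in> ?\<N>" using assms(2) by simp
  show ?thesis
    unfolding normal_closure_def
  proof (rule normal_invI)
    show "subgroup (\<Inter> ?\<N>) G"
      using ne by (intro subgroups_Inter) (auto simp: normal_def)
    show "g \<otimes>\<^bsub>G\<^esub> h \<otimes>\<^bsub>G\<^esub> inv\<^bsub>G\<^esub> g \<in> \<Inter> ?\<N>" if "g \<in> carrier G" "h \<in> \<Inter> ?\<N>" for g h
      using that by (auto simp: normal_inv_iff)
  qed
qed

lemma normal_relator_subgroup:
  "R \<subseteq> words A \<Longrightarrow> relator_subgroup A R \<lhd> free_group A"
  unfolding relator_subgroup_def
  by (intro normal_normal_closure group_free_group) (auto intro: reduce_in_free_group)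

lemma group_presented_group: "R \<subseteq> words A \<Longrightarrow> group (presented_group A R)"
  unfolding presented_group_def by (intro normal.factorgroup_is_group normal_relator_subgroup)

lemma word_class_in_presented_group:
  "w \<in> words A \<Longrightarrow> word_class A R w \<in> carrier (presented_group A R)"
  by (auto simp: word_class_def presented_group_def FactGroup_def RCOSETS_def
      intro: reduce_in_free_group)

text \<open>The word written out: \<open>x y\<^sup>-\<^sup>i x\<^sup>-\<^sup>1 y\<^sup>-\<^sup>i x\<^sup>-\<^sup>1 \<cdot> y \<cdot> x y\<^sup>i x y\<^sup>i x\<^sup>-\<^sup>1 \<cdot> x\<^sup>-\<^sup>1 y\<^sup>-\<^sup>1 x\<close>.\<close>

lemma a_word_explicit:
  "a_word i =
     [(Gen_x, True)] @ replicate i (Gen_y, False) @ [(Gen_x, False)] @ replicate i (Gen_y, False) @ [(Gen_x, False)] @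
     [(Gen_y, True)] @
     [(Gen_x, True)] @ replicate i (Gen_y, True) @ [(Gen_x, True)] @ replicate i (Gen_y, True) @ [(Gen_x, False)] @
     [(Gen_x, False), (Gen_y, False), (Gen_x, True)]"
proof -
  have "pow_word [l] n = replicate n l" for l :: "xy letter" and n
    by (induction n) (auto simp: pow_word_def)
  then show ?thesis
    by (simp add: a_word_def conj_word_def inv_word_def inv_letter_def)
      (simp add: pow_word_def numeral_2_eq_2 inv_letter_def)
qed

end

theory Submission
  imports Defs
begin

text \<open>
  For any permutations \<open>g\<^sub>1, g\<^sub>2, \<dots>\<close> of a set \<open>H\<close> there are permutations \<open>x, y\<close> of
  \<open>H \<times> \<int>\<^sup>3 \<times> \<int>\<close> for which \<open>a\<^sub>i(x, y)\<close> is \<open>g\<^sub>i\<close> on the fibre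
  over the origin and the identity elsewhere. Applied to the left translations of \<open>G\<close> by its
  generators, this makes \<open>T\<^sub>G\<close> act on the larger set, and the element of \<open>T\<^sub>G\<close> given by
  a word in the \<open>a\<^sub>i(x, y)\<close> is trivial only if the corresponding element of \<open>G\<close> is.

  Let \<open>x\<close> shift the last coordinate \<open>k\<close> and let \<open>y\<close> act on level \<open>k\<close> by \<open>F\<^sub>k\<close>. Then
  \<open>a\<^sub>i\<close> acts on level \<open>k\<close> by
  \<open>F\<^bsub>k-1\<^esub>\<^sup>-\<^sup>i F\<^sub>k\<^sup>-\<^sup>i F\<^bsub>k+1\<^esub> F\<^sub>k\<^sup>i F\<^bsub>k-1\<^esub>\<^sup>i F\<^bsub>k+1\<^esub>\<^sup>-\<^sup>1\<close>.
  With \<open>F\<^bsub>-2\<^esub> = F\<^bsub>-1\<^esub>\<^sup>-\<^sup>1\<close> and \<open>F\<^sub>k = 1\<close> for \<open>k\<close> outside \<open>{-2..1}\<close>, this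
  is trivial for \<open>k \<noteq> 0\<close>. On level \<open>0\<close>, take \<open>F\<^sub>0 = up\<close> and \<open>F\<^bsub>-1\<^esub> = down\<close> acting on
  \<open>\<int>\<^sup>3\<close> only, and \<open>F\<^sub>1(h, p) = (\<theta>\<^sub>p h, p)\<close>; what is needed then is
  \<open>\<theta>\<^bsub>q\<^esub> = \<theta>\<^sub>p\<close> for \<open>q = up\<^sup>i (down\<^sup>i p)\<close>, except that
  \<open>\<theta>\<^bsub>q\<^esub> = g\<^sub>i\<close> and \<open>\<theta>\<^sub>p = 1\<close> if \<open>p\<close> is the origin.
  This holds if \<open>\<theta>\<close> at \<open>(n, m, j)\<close> is \<open>g\<^sub>n\<close> for \<open>j = n \<ge> 1\<close> and \<open>1\<close> otherwise.
\<close>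

section \<open>Words acting by permutations\<close>

abbreviation perm_inv :: "('b \<Rightarrow> 'b) \<Rightarrow> 'b \<Rightarrow> 'b" where
  "perm_inv \<equiv> inv_into UNIV"

definition perm_group :: "('b \<Rightarrow> 'b) monoid" where
  "perm_group = \<lparr> carrier = {h. bij h}, monoid.mult = (\<circ>), one = id \<rparr>"

lemma perm_group_simps [simp]:
  "carrier perm_group = {h. bij h}" "g \<otimes>\<^bsub>perm_group\<^esub> h = g \<circ> h" "\<one>\<^bsub>perm_group\<^esub> = id"
  by (simp_all add: perm_group_def)

lemma group_perm_group: "group perm_group"
proof (rule groupI)
  fix h :: "'b \<Rightarrow> 'b" assume "h \<in> carrier perm_group"
  then show "\<exists>g\<in>carrier perm_group. g \<otimes>\<^bsub>perm_group\<^esub> h = \<one>\<^bsub>perm_group\<^esub>"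
    by (intro bexI [of _ "perm_inv h"]) (auto simp: bij_imp_bij_inv bij_is_inj)
qed (auto simp: bij_comp o_assoc)

primrec act :: "('a \<Rightarrow> 'b \<Rightarrow> 'b) \<Rightarrow> 'a word \<Rightarrow> 'b \<Rightarrow> 'b" where
  "act f [] = id"
| "act f (l # w) = (if snd l then f (fst l) else perm_inv (f (fst l))) \<circ> act f w"

lemma act_append: "act f (u @ v) = act f u \<circ> act f v"
  by (induction u) (auto simp: o_assoc)

lemma bij_act: "(\<And>a. bij (f a)) \<Longrightarrow> bij (act f w)"
  by (induction w) (auto intro: bij_comp bij_imp_bij_inv)

lemma act_cong: "w \<in> words A \<Longrightarrow> (\<And>a. a \<in> A \<Longrightarrow> f a = g a) \<Longrightarrow> act f w = act g w"
  by (induction w) (auto simp: words_def)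

lemma act_cancel_cons:
  assumes "\<And>a. bij (f a)"
  shows "act f (cancel_cons l w) = act f (l # w)"
proof -
  have "f a \<circ> perm_inv (f a) = id" "perm_inv (f a) \<circ> f a = id" for a
    using assms [of a] surj_iff inj_iff by (auto simp: bij_def)
  then show ?thesis
    by (auto simp: cancel_cons_def inv_letter_def o_assoc split: list.splits)
qed

lemma reduce_Cons: "reduce (l # w) = cancel_cons l (reduce w)"
  by (simp add: reduce_def)

lemma act_reduce: "(\<And>a. bij (f a)) \<Longrightarrow> act f (reduce w) = act f w"
proof (induction w)
  case (Cons l w)
  then show ?case by (simp add: reduce_Cons act_cancel_cons)
qed (simp add: reduce_def)

lemma act_inv_word:
  assumes "\<And>a. bij (f a)"
  shows "act f (inv_word w) = perm_inv (act f w)"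
proof -
  have "act f (inv_word w) \<circ> act f w = act f (reduce (inv_word w @ w))"
    by (simp only: act_reduce [OF assms] act_append)
  then have "act f (inv_word w) \<circ> act f w = id" by simp
  then show ?thesis
    using bij_act [of f w, OF assms] by (metis bij_def surj_iff o_assoc id_o o_id)
qed

lemma act_subst_word:
  assumes "\<And>a. bij (f a)"
  shows "act f (subst_word s w) = act (\<lambda>a. act f (s a)) w"
  by (induction w) (auto simp: subst_word_def act_append act_inv_word [OF assms])

lemma act_replicate:
  "act f (replicate n (a, True)) = f a ^^ n" "act f (replicate n (a, False)) = perm_inv (f a) ^^ n"
  by (induction n) auto

lemma act_hom: "(\<And>a. bij (f a)) \<Longrightarrow> act f \<in> hom (free_group A) perm_group"
  by (rule homI) (auto simp: bij_act act_reduce act_append free_group_def)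

lemma normal_closure_subset: "N \<lhd> G \<Longrightarrow> S \<subseteq> N \<Longrightarrow> normal_closure G S \<subseteq> N"
  by (auto simp: normal_closure_def)

text \<open>The kernel of the action is normal and contains the reduced relators, hence also their
  normal closure.\<close>

lemma act_relator_subgroup:
  assumes "\<And>a. bij (f a)" "R \<subseteq> words A" "\<And>w. w \<in> R \<Longrightarrow> act f w = id" "w \<in> relator_subgroup A R"
  shows "act f w = id"
proof -
  interpret group_hom "free_group A" perm_group "act f"
    using act_hom [of f] assms(1)
    by (simp add: group_hom_def group_hom_axioms_def group_free_group group_perm_group)
  have "reduce ` R \<subseteq> kernel (free_group A) perm_group (act f)"
    using assms(2,3) by (auto simp: kernel_def act_reduce [OF assms(1)] reduce_in_free_group)
  then have "relator_subgroup A R \<subseteq> kernel (free_group A) perm_group (act f)"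
    unfolding relator_subgroup_def by (intro normal_closure_subset normal_kernel)
  then show ?thesis using assms(4) by (auto simp: kernel_def)
qed

text \<open>Extended by the identity outside the carrier, so that it is a permutation of the whole type.\<close>

definition left_mult :: "('g, 'm) monoid_scheme \<Rightarrow> 'g \<Rightarrow> 'g \<Rightarrow> 'g" where
  "left_mult G g h = (if h \<in> carrier G then g \<otimes>\<^bsub>G\<^esub> h else h)"

lemma (in group) left_mult_mult:
  "g \<in> carrier G \<Longrightarrow> g' \<in> carrier G \<Longrightarrow> left_mult G (g \<otimes> g') = left_mult G g \<circ> left_mult G g'"
  by (auto simp: left_mult_def m_assoc)

lemma (in group) left_mult_one: "left_mult G \<one> = id"
  by (auto simp: left_mult_def)

lemma (in group) left_mult_inverse:
  assumes "g \<in> carrier G"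
  shows "left_mult G g \<circ> left_mult G (inv g) = id" "left_mult G (inv g) \<circ> left_mult G g = id"
  using left_mult_mult [of g "inv g"] left_mult_mult [of "inv g" g] assms by (auto simp: left_mult_one)

lemma (in group) bij_left_mult: "g \<in> carrier G \<Longrightarrow> bij (left_mult G g)"
  using left_mult_inverse by (metis o_bij)

lemma (in group) inv_left_mult: "g \<in> carrier G \<Longrightarrow> perm_inv (left_mult G g) = left_mult G (inv g)"
  using left_mult_inverse by (metis inv_unique_comp)

section \<open>The permutation representation\<close>

definition up :: "int \<times> int \<times> int \<Rightarrow> int \<times> int \<times> int" where
  "up = (\<lambda>(n, m, j). (n, m, j + 1))"

text \<open>\<open>down\<close> is inverse to \<open>up\<close> except near the points \<open>(n, 0, 0)\<close>, which form a separate
  \<open>down\<close>-orbit; so \<open>up\<^sup>i down\<^sup>i\<close> sends the origin to \<open>(i, 0, i)\<close>. The orbits cut by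
  removing \<open>(n, 0, 0)\<close> are rejoined through neighbouring values of \<open>m\<close>, in such a way that
  \<open>up\<^sup>i down\<^sup>i\<close> fixes \<open>n\<close> and \<open>j\<close> at all points \<open>(n, m, j)\<close> off this orbit.\<close>

definition down :: "int \<times> int \<times> int \<Rightarrow> int \<times> int \<times> int" where
  "down = (\<lambda>(n, m, j).
     if m = 0 \<and> j = 0 then (n + 1, 0, 0)
     else if m \<ge> 0 \<and> j = 1 then (n, m + 1, 0)
     else if m < 0 \<and> j = 0 then (n, m + 1, - 1)
     else (n, m, j - 1))"

definition label :: "(nat \<Rightarrow> 'b \<Rightarrow> 'b) \<Rightarrow> int \<times> int \<times> int \<Rightarrow> 'b \<Rightarrow> 'b" where
  "label g = (\<lambda>(n, m, j). if j = n \<and> n \<ge> 1 then g (nat n) else id)"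

lemma bij_up: "bij up"
  by (rule o_bij [of "\<lambda>(n, m, j). (n, m, j - 1)"]) (auto simp: up_def)

lemma bij_down: "bij down"
proof (rule o_bij)
  let ?d = "\<lambda>(n, m, j). if j = 0 \<and> m = 0 then (n - 1, 0, 0)
     else if j = 0 \<and> m \<ge> 1 then (n, m - 1, 1)
     else if j = - 1 \<and> m \<le> 0 then (n, m - 1, 0)
     else (n, m, j + 1) :: int \<times> int \<times> int"
  show "?d \<circ> down = id" "down \<circ> ?d = id" by (auto simp: down_def fun_eq_iff)
qed

lemma up_power: "(up ^^ i) (n, m, j) = (n, m, j + int i)"
  by (induction i) (auto simp: up_def)

lemma down_power_axis: "(down ^^ i) (n, 0, 0) = (n + int i, 0, 0)"
  by (induction i) (auto simp: down_def)

text \<open>Each step lowers \<open>j\<close> by one, so the jump from \<open>m\<close> to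
  \<open>m + 1\<close> happens at most once, on leaving \<open>j = 1\<close> or
  \<open>j = 0\<close>; the orbit never meets a point \<open>(n, 0, 0)\<close>.\<close>

lemma down_power:
  assumes "\<not> (m = 0 \<and> j = 0)"
  shows "(down ^^ i) (n, m, j) =
    (n, if (m \<ge> 0 \<and> 1 \<le> j \<and> j \<le> int i) \<or> (m < 0 \<and> 0 \<le> j \<and> j < int i) then m + 1 else m, j - int i)"
proof (induction i)
  case 0
  then show ?case by simp
next
  case (Suc i)
  show ?case
    using assms by (simp add: Suc) (simp add: down_def; presburger)
qed

text \<open>Off the axis only \<open>m\<close> can change, and \<open>label\<close> ignores it. An
  axis point \<open>(n, 0, 0)\<close> goes to \<open>(n + i, 0, i)\<close>, which can carry a
  nontrivial label only for \<open>n = 0\<close>.\<close>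

lemma label_up_down:
  assumes "i \<ge> 1"
  shows "label g ((up ^^ i) ((down ^^ i) p)) = (if p = (0, 0, 0) then g i else label g p)"
proof (cases p)
  case (fields n m j)
  show ?thesis
  proof (cases "m = 0 \<and> j = 0")
    case True
    then show ?thesis using assms fields by (auto simp: down_power_axis up_power label_def)
  next
    case False
    then show ?thesis using fields by (auto simp: down_power up_power label_def)
  qed
qed

text \<open>The maps \<open>F\<^sub>k\<close> of the introduction.\<close>

definition fibre :: "(nat \<Rightarrow> 'b \<Rightarrow> 'b) \<Rightarrow> int \<Rightarrow> 'b \<times> (int \<times> int \<times> int) \<Rightarrow> 'b \<times> (int \<times> int \<times> int)" where
  "fibre g k =
     (if k = 1 then (\<lambda>(h, p). (label g p h, p))
      else if k = 0 then map_prod id up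
      else if k = - 1 then map_prod id down
      else if k = - 2 then map_prod id (perm_inv down)
      else id)"

fun gen_perm :: "(int \<Rightarrow> 'c \<Rightarrow> 'c) \<Rightarrow> xy \<Rightarrow> 'c \<times> int \<Rightarrow> 'c \<times> int" where
  "gen_perm F Gen_x (c, k) = (c, k + 1)"
| "gen_perm F Gen_y (c, k) = (F k c, k)"


section \<open>Action of the words \<open>a_word i\<close> level by level\<close>

lemma inv_map_prod_id: "bij f \<Longrightarrow> perm_inv (map_prod id f) = map_prod id (perm_inv f)"
  by (rule inv_unique_comp)
    (auto simp: fun_eq_iff bij_is_inj bij_is_surj surj_f_inv_f)

lemma map_prod_id_power: "(map_prod id f ^^ i) (h, p) = (h, ((f :: 'b \<Rightarrow> 'b) ^^ i) p)"
  by (induction i) auto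

lemma inv_power_cancel:
  assumes "bij f"
  shows "(perm_inv f ^^ i) ((f ^^ i) c) = c" "(f ^^ i) ((perm_inv f ^^ i) c) = c"
  using inv_fn_o_fn_is_id [OF assms, of i] fn_o_inv_fn_is_id [OF assms, of i]
  by (simp_all add: fun_eq_iff)

lemma inv_gen_perm:
  assumes "\<And>k. bij (F k)"
  shows "perm_inv (gen_perm F Gen_x) = (\<lambda>(c, k). (c, k - 1))"
    "perm_inv (gen_perm F Gen_y) = gen_perm (\<lambda>k. perm_inv (F k)) Gen_y"
  by (rule inv_unique_comp;
    use assms in \<open>auto simp: fun_eq_iff bij_is_inj bij_is_surj surj_f_inv_f\<close>)+

lemma bij_gen_perm:
  assumes "\<And>k. bij (F k)"
  shows "bij (gen_perm F a)"
proof (cases a)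
  case Gen_x
  then show ?thesis by (intro o_bij [of "\<lambda>(c, k). (c, k - 1)"]) (auto simp: fun_eq_iff)
next
  case Gen_y
  then show ?thesis using assms
    by (intro o_bij [of "gen_perm (\<lambda>k. perm_inv (F k)) Gen_y"])
      (auto simp: fun_eq_iff bij_is_inj bij_is_surj surj_f_inv_f)
qed

lemma gen_perm_y_power: "(gen_perm F Gen_y ^^ i) (c, k) = ((F k ^^ i) c, k)"
  by (induction i) auto

text \<open>Letters act from right to left, so the shifts by \<open>x\<close> place the powers of
  \<open>y\<close> at levels \<open>k + 1\<close>, \<open>k - 1\<close>, \<open>k\<close>,
  \<open>k + 1\<close>, \<open>k\<close>, \<open>k - 1\<close> in turn.\<close>

lemma act_a_word:
  assumes "\<And>k. bij (F k)"
  shows "act (gen_perm F) (a_word i) (c, k) =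
    ((perm_inv (F (k - 1)) ^^ i) ((perm_inv (F k) ^^ i) (F (k + 1)
      ((F k ^^ i) ((F (k - 1) ^^ i) (perm_inv (F (k + 1)) c))))), k)"
  by (simp add: a_word_explicit act_append act_replicate inv_gen_perm [OF assms] gen_perm_y_power)

lemma bij_label: "(\<And>i. bij (g i)) \<Longrightarrow> bij (label g p)"
  by (cases p) (auto simp: label_def)

lemma fibre_simps [simp]:
  "fibre g 1 = (\<lambda>(h, p). (label g p h, p))" "fibre g 0 = map_prod id up"
  "fibre g (- 1) = map_prod id down" "fibre g (- 2) = map_prod id (perm_inv down)"
  by (auto simp: fibre_def)

lemma fibre_trivial: "k \<notin> {- 2..1} \<Longrightarrow> fibre g k = id"
  by (auto simp: fibre_def)

lemma inv_label_map:
  assumes "\<And>i. bij (g i)"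
  shows "perm_inv (\<lambda>(h, p). (label g p h, p)) = (\<lambda>(h, p). (perm_inv (label g p) h, p))"
  using bij_label [of g, OF assms]
  by (intro inv_unique_comp) (auto simp: fun_eq_iff bij_is_inj bij_is_surj surj_f_inv_f)

lemma bij_fibre:
  assumes "\<And>i. bij (g i)"
  shows "bij (fibre g k)"
proof -
  have "bij (map_prod id f)" if "bij f" for f :: "int \<times> int \<times> int \<Rightarrow> int \<times> int \<times> int"
    using that by (intro o_bij [of "map_prod id (perm_inv f)"])
      (auto simp: fun_eq_iff bij_is_inj bij_is_surj surj_f_inv_f)
  moreover have "bij (\<lambda>(h, p). (label g p h, p))"
    using bij_label [of g, OF assms]
    by (intro o_bij [of "\<lambda>(h, p). (perm_inv (label g p) h, p)"])
      (auto simp: fun_eq_iff bij_is_inj bij_is_surj surj_f_inv_f)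
  ultimately show ?thesis
    using bij_up bij_down bij_imp_bij_inv [OF bij_down] by (auto simp: fibre_def)
qed

text \<open>An injective homomorphism of permutations (\<open>at_base_comp\<close>,
  \<open>at_base_eq_id_iff\<close>), so relations are neither gained nor lost on the larger
  set.\<close>

definition at_base :: "('b \<Rightarrow> 'b) \<Rightarrow> ('b \<times> (int \<times> int \<times> int)) \<times> int \<Rightarrow> ('b \<times> (int \<times> int \<times> int)) \<times> int" where
  "at_base f = (\<lambda>((h, p), k). ((if k = 0 \<and> p = (0, 0, 0) then f h else h, p), k))"

lemma at_base_comp: "at_base (f \<circ> g) = at_base f \<circ> at_base g"
  by (auto simp: at_base_def fun_eq_iff)

lemma at_base_eq_id_iff [simp]: "at_base f = id \<longleftrightarrow> f = id"
  by (auto simp: at_base_def fun_eq_iff split: if_splits)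

lemma inv_at_base:
  assumes "bij f"
  shows "perm_inv (at_base f) = at_base (perm_inv f)"
proof (rule inv_unique_comp)
  have "f \<circ> perm_inv f = id" "perm_inv f \<circ> f = id"
    using assms by (auto simp: bij_def surj_iff inj_iff)
  then show "at_base f \<circ> at_base (perm_inv f) = id" "at_base (perm_inv f) \<circ> at_base f = id"
    by (simp_all flip: at_base_comp)
qed

lemma act_at_base:
  assumes "\<And>i. bij (g i)"
  shows "act (\<lambda>i. at_base (g i)) w = at_base (act g w)"
proof (induction w)
  case Nil
  show ?case by (metis act.simps(1) at_base_eq_id_iff)
next
  case (Cons l w)
  then show ?case by (cases "snd l") (simp_all only: act.simps at_base_comp inv_at_base [OF assms] if_True if_False)
qed

lemma act_a_word_fibre:
  assumes "\<And>i. bij (g i)" "i \<ge> 1"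
  shows "act (gen_perm (fibre g)) (a_word i) = at_base (g i)"
proof
  fix q :: "('a \<times> (int \<times> int \<times> int)) \<times> int"
  obtain h p k where q: "q = ((h, p), k)" by (metis surj_pair)
  note cancel = inv_power_cancel [OF bij_fibre [of g, OF assms(1)]]
  have inv1: "fibre g k (perm_inv (fibre g k) c) = c" for k c
    using bij_fibre [of g, OF assms(1)] by (simp add: bij_is_surj surj_f_inv_f)
  note formula = act_a_word [of "fibre g", OF bij_fibre [of g, OF assms(1)]]
  have down_down: "(down ^^ i) ((perm_inv down ^^ i) p) = p" for p
    using inv_power_cancel [OF bij_down] by auto
  consider "k = 0" | "k = - 1" | "k = - 2" | "k = - 3" | "k + 1 \<notin> {- 2..1}" by fastforce
  then show "act (gen_perm (fibre g)) (a_word i) q = at_base (g i) q"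
  proof cases
    case 1
    \<comment> \<open>On \<open>h\<close> the inverse label at \<open>p\<close> acts first, then the
      label at the displaced point; the displacement is undone afterwards.\<close>
    have "perm_inv (label g p) h = h" if "p = (0, 0, 0)"
      using that by (simp add: label_def)
    moreover have "label g p (perm_inv (label g p) h) = h"
      using bij_label [of g, OF assms(1)] by (simp add: bij_is_surj surj_f_inv_f)
    moreover have "(perm_inv down ^^ i) ((perm_inv up ^^ i) ((up ^^ i) ((down ^^ i) p))) = p"
      by (simp add: inv_power_cancel bij_up bij_down)
    ultimately show ?thesis using 1 q assms(2)
      by (simp add: formula inv_label_map [OF assms(1)] map_prod_id_power inv_map_prod_id
        bij_up bij_down label_up_down at_base_def)
  next
    case 2
    \<comment> \<open>Levels -2 and -1 carry mutually inverse maps, so their \<open>i\<close>-th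
      powers cancel and \<open>up\<close> meets its inverse.\<close>
    have "perm_inv (perm_inv down) = down" by (rule inv_inv_eq [OF bij_down])
    then show ?thesis using 2 q bij_imp_bij_inv [OF bij_down]
      by (simp add: formula map_prod_id_power inv_map_prod_id bij_up bij_down down_down at_base_def
        inv_power_cancel surj_f_inv_f bij_is_surj)
  next
    case 3
    \<comment> \<open>Level -3 is trivial; what remains is a commutator of powers of
      \<open>down\<close>.\<close>
    have "(down ^^ i) (down ((perm_inv down ^^ i) (perm_inv down p))) = p"
      using inv_power_cancel(2) [OF bij_down, of "Suc i" p] by (simp add: funpow_swap1)
    moreover have "perm_inv (perm_inv down) = down" by (rule inv_inv_eq [OF bij_down])
    ultimately show ?thesis using 3 q bij_imp_bij_inv [OF bij_down]
      by (simp add: formula fibre_trivial id_funpow map_prod_id_power inv_map_prod_id bij_down at_base_def)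
  next
    case 4
    then show ?thesis
      using q inv1 [of "- 2"] by (simp add: formula fibre_trivial id_funpow at_base_def del: fibre_simps)
  next
    case 5
    \<comment> \<open>With a trivial map at level \<open>k + 1\<close>, the outer powers undo the
      inner ones.\<close>
    then have "k \<noteq> 0" by auto
    then show ?thesis
      using 5 q by (simp add: formula fibre_trivial [of "k + 1"] cancel at_base_def del: fibre_simps)
  qed
qed

section \<open>Presented groups\<close>

lemma words_Nil [simp]: "[] \<in> words A"
  by (simp add: words_def)

lemma words_Cons [simp]: "l # w \<in> words A \<longleftrightarrow> fst l \<in> A \<and> w \<in> words A"
  by (cases l) (auto simp: words_def)

lemma word_class_hom:
  assumes "R \<subseteq> words A"
  shows "word_class A R \<in> hom (free_group A) (presented_group A R)"
proof -
  interpret normal "relator_subgroup A R" "free_group A"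
    by (rule normal_relator_subgroup [OF assms])
  have eq: "word_class A R w = relator_subgroup A R #>\<^bsub>free_group A\<^esub> w" if "w \<in> carrier (free_group A)" for w
    using that by (simp add: word_class_def free_group_def)
  show ?thesis
    using r_coset_hom_Mod by (simp add: hom_def Pi_def eq flip: presented_group_def)
qed

lemma word_class_reduce [simp]: "word_class A R (reduce w) = word_class A R w"
  by (simp add: word_class_def)

lemma word_class_append:
  assumes "R \<subseteq> words A" "u \<in> words A" "v \<in> words A"
  shows "word_class A R (u @ v) = word_class A R u \<otimes>\<^bsub>presented_group A R\<^esub> word_class A R v"
proof -
  have "word_class A R (reduce u \<otimes>\<^bsub>free_group A\<^esub> reduce v)
      = word_class A R (reduce u) \<otimes>\<^bsub>presented_group A R\<^esub> word_class A R (reduce v)"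
    using hom_mult [OF word_class_hom [OF assms(1)]] assms(2,3) by (simp add: reduce_in_free_group)
  then show ?thesis by (simp add: free_group_def)
qed

lemma word_class_eq_one_iff:
  assumes "R \<subseteq> words A" "w \<in> words A"
  shows "word_class A R w = \<one>\<^bsub>presented_group A R\<^esub> \<longleftrightarrow> reduce w \<in> relator_subgroup A R"
proof -
  interpret normal "relator_subgroup A R" "free_group A"
    by (rule normal_relator_subgroup [OF assms(1)])
  show ?thesis
    using coset_join1 [OF _ reduce_in_free_group [OF assms(2)] subgroup_axioms]
      coset_join2 [OF reduce_in_free_group [OF assms(2)] subgroup_axioms]
    by (auto simp: word_class_def presented_group_def FactGroup_def)
qed

lemma word_class_Nil: "R \<subseteq> words A \<Longrightarrow> word_class A R [] = \<one>\<^bsub>presented_group A R\<^esub>"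
  using word_class_eq_one_iff [of R A "[]"] normal_relator_subgroup [of R A] 
    subgroup.one_closed [of "relator_subgroup A R" "free_group A"]
  by (auto simp: normal_def free_group_def reduce_def)

lemma word_class_inverse_letter:
  assumes "R \<subseteq> words A" "a \<in> A"
  shows "word_class A R [(a, False)] = inv\<^bsub>presented_group A R\<^esub> word_class A R [(a, True)]"
proof -
  interpret group "presented_group A R" by (rule group_presented_group [OF assms(1)])
  have "word_class A R [(a, False)] \<otimes>\<^bsub>presented_group A R\<^esub> word_class A R [(a, True)] = word_class A R (reduce ([(a, False)] @ [(a, True)]))"
    using assms by (simp only: word_class_reduce) (simp flip: word_class_append)
  also have "\<dots> = \<one>\<^bsub>presented_group A R\<^esub>"
    using reduce_inv_word_append [of "[(a, True)]"] word_class_Nil [OF assms(1)]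
    by (simp add: inv_word_def inv_letter_def)
  finally show ?thesis
    using assms by (intro inv_equality [symmetric]) (auto intro: word_class_in_presented_group)
qed

lemma presented_groupE:
  assumes "g \<in> carrier (presented_group A R)"
  obtains w where "w \<in> words A" "reduced w" "g = word_class A R w"
  using assms by (auto simp: presented_group_def FactGroup_def RCOSETS_def word_class_def free_group_def)

text \<open>Yields uniqueness of the embedding: every element is a product of generator classes and
  their inverses.\<close>

lemma hom_presented_group_eqI:
  assumes "R \<subseteq> words A" "group H"
    and "\<gamma> \<in> hom (presented_group A R) H" "\<delta> \<in> hom (presented_group A R) H"
    and gen: "\<And>a. a \<in> A \<Longrightarrow> \<gamma> (word_class A R [(a, True)]) = \<delta> (word_class A R [(a, True)])"
    and "g \<in> carrier (presented_group A R)"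
  shows "\<gamma> g = \<delta> g"
proof -
  interpret \<gamma>: group_hom "presented_group A R" H \<gamma>
    using assms by (simp add: group_hom_def group_hom_axioms_def group_presented_group)
  interpret \<delta>: group_hom "presented_group A R" H \<delta>
    using assms by (simp add: group_hom_def group_hom_axioms_def group_presented_group)
  obtain w where w: "w \<in> words A" "g = word_class A R w" using assms(6) by (rule presented_groupE)
  have letter: "\<gamma> (word_class A R [l]) = \<delta> (word_class A R [l])" if "fst l \<in> A" for l
    using that gen word_class_in_presented_group [of "[(fst l, True)]" A R]
    by (cases l; cases "snd l") (auto simp: word_class_inverse_letter [OF assms(1)])
  have "\<gamma> (word_class A R w) = \<delta> (word_class A R w)"
    using w(1)
  proof (induction w)
    case Nil
    then show ?case using word_class_Nil [OF assms(1)] by simp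
  next
    case (Cons l w)
    then show ?case
      using word_class_append [OF assms(1), of "[l]" w] letter [of l]
      by (simp add: word_class_in_presented_group)
  qed
  then show ?thesis using w by simp
qed

section \<open>Substitution and free reduction\<close>

lemma inv_word_inv_word [simp]: "inv_word (inv_word w) = w"
  by (simp add: inv_word_def rev_map comp_def)

lemma subst_word_append: "subst_word f (u @ v) = subst_word f u @ subst_word f v"
  by (simp add: subst_word_def)

lemma subst_word_inv_letter: "subst_word f [inv_letter l] = inv_word (subst_word f [l])"
  by (auto simp: subst_word_def inv_letter_def split: prod.splits)

lemma reduce_append_inv_word: "reduce (w @ inv_word w @ v) = reduce v"
proof -
  have "reduce (w @ inv_word w @ v) = reduce (reduce (w @ inv_word w) @ v)"
    by (simp only: reduce_append_left append_assoc)
  also have "reduce (w @ inv_word w) = []" using reduce_inv_word_append [of "inv_word w"] by simp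
  finally show ?thesis by simp
qed

text \<open>A cancelling pair of letters becomes a word next to its inverse, so substitution
  descends to free groups.\<close>

lemma reduce_subst_reduce: "reduce (subst_word f (reduce w)) = reduce (subst_word f w)"
proof (induction w)
  case (Cons l w)
  have "reduce (subst_word f (cancel_cons l v)) = reduce (subst_word f [l] @ subst_word f v)" for v
  proof (cases "\<exists>v'. v = inv_letter l # v'")
    case True
    then obtain v' where v: "v = [inv_letter l] @ v'" by auto
    show ?thesis
      unfolding v subst_word_append subst_word_inv_letter reduce_append_inv_word
      by (simp add: cancel_cons_def)
  next
    case False
    then have "cancel_cons l v = [l] @ v" by (auto simp: cancel_cons_def split: list.splits)
    then show ?thesis by (simp only: subst_word_append)
  qed
  then have "reduce (subst_word f (reduce (l # w))) = reduce (subst_word f [l] @ reduce (subst_word f (reduce w)))"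
    by (simp add: reduce_Cons)
  then show ?case using Cons subst_word_append [of f "[l]" w] by simp
qed (simp add: reduce_def)

lemma words_UNIV [simp]: "w \<in> words UNIV"
  by (simp add: words_def)

lemma act_left_mult:
  assumes "R \<subseteq> words A" "w \<in> words A"
    and "\<And>a. a \<in> A \<Longrightarrow> f a = left_mult (presented_group A R) (word_class A R [(a, True)])"
  shows "act f w = left_mult (presented_group A R) (word_class A R w)"
proof -
  interpret group "presented_group A R" by (rule group_presented_group [OF assms(1)])
  show ?thesis
    using assms(2)
  proof (induction w)
    case Nil
    then show ?case by (simp add: word_class_Nil [OF assms(1)] left_mult_one)
  next
    case (Cons l w)
    then have "(if snd l then f (fst l) else perm_inv (f (fst l))) = left_mult (presented_group A R) (word_class A R [l])"
      by (cases l) (auto simp: assms(3) inv_left_mult word_class_in_presented_group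
        word_class_inverse_letter [OF assms(1)])
    then show ?case
      using Cons word_class_append [OF assms(1), of "[l]" w]
      by (simp add: left_mult_mult word_class_in_presented_group)
  qed
qed

section \<open>The embedding\<close>

lemma subst_a_word_in_relator_subgroup:
  assumes "R \<subseteq> words I" "0 \<notin> I" "w \<in> words I"
    and rel: "reduce (subst_word a_word w) \<in> relator_subgroup UNIV (subst_word a_word ` R)"
  shows "reduce w \<in> relator_subgroup I R"
proof -
  let ?G = "presented_group I R"
  interpret group ?G by (rule group_presented_group [OF assms(1)])
  \<comment> \<open>The value \<open>id\<close> outside \<open>I\<close> makes every
    \<open>g i\<close> a bijection.\<close>
  define g where "g i = (if i \<in> I then left_mult ?G (word_class I R [(i, True)]) else id)" for i
  have bij_g: "bij (g i)" for i
    by (simp add: g_def bij_left_mult word_class_in_presented_group)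
  have act_g: "act g v = left_mult ?G (word_class I R v)" if "v \<in> words I" for v
    using assms(1) that by (rule act_left_mult) (simp add: g_def)
  let ?X = "gen_perm (fibre g)"
  have bij_X: "bij (?X a)" for a by (intro bij_gen_perm bij_fibre bij_g)
  have act_X: "act ?X (subst_word a_word v) = at_base (act g v)" if "v \<in> words I" for v
  proof -
    have "act ?X (subst_word a_word v) = act (\<lambda>i. at_base (g i)) v"
      unfolding act_subst_word [of ?X, OF bij_X]
      using that
    proof (rule act_cong)
      fix i assume "i \<in> I"
      \<comment> \<open>Index 0 has to be excluded: \<open>a_word 0\<close> reduces to the empty
        word.\<close>
      then have "i \<ge> 1" using assms(2) by (cases i) auto
      then show "act ?X (a_word i) = at_base (g i)" by (rule act_a_word_fibre [of g, OF bij_g])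
    qed
    then show ?thesis by (simp add: act_at_base [of g, OF bij_g])
  qed
  have "act ?X (reduce (subst_word a_word w)) = id"
  proof (rule act_relator_subgroup [OF bij_X _ _ rel])
    show "act ?X v = id" if v: "v \<in> subst_word a_word ` R" for v
    proof -
      obtain u where u: "u \<in> R" "u \<in> words I" "v = subst_word a_word u" using v assms(1) by blast
      then have "reduce u \<in> relator_subgroup I R"
        by (auto simp: relator_subgroup_def normal_closure_def)
      then have "word_class I R u = \<one>\<^bsub>?G\<^esub>" using assms(1) u by (simp add: word_class_eq_one_iff)
      then show ?thesis using u by (simp add: act_X act_g left_mult_one)
    qed
  qed auto
  \<comment> \<open>Left translation is faithful: its value at the identity is the class of
    \<open>w\<close> itself.\<close>
  then have "left_mult ?G (word_class I R w) \<one>\<^bsub>?G\<^esub> = \<one>\<^bsub>?G\<^esub>"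
    using assms(3) by (simp add: act_reduce [of ?X, OF bij_X] act_X act_g)
  then show ?thesis
    using assms(1,3) by (simp add: left_mult_def word_class_in_presented_group flip: word_class_eq_one_iff)
qed

theorem theorem1p1:
  fixes I J :: "nat set" and r :: "nat \<Rightarrow> nat word"
  assumes "I = {1..} \<or> (\<exists>n. I = {1..n})"
    and "J = {1..} \<or> (\<exists>n. J = {1..n})"
    and "\<forall>s\<in>J. r s \<in> words I"
  shows
    "let R = r ` J;
         R' = (\<lambda>s. subst_word a_word (r s)) ` J;
         G = presented_group I R;
         T\<^sub>G = presented_group (UNIV :: xy set) R'
     in \<exists>\<gamma>. \<gamma> \<in> mon G T\<^sub>G
          \<and> (\<forall>i\<in>I. \<gamma> (word_class I R [(i, True)]) = word_class UNIV R' (a_word i))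
          \<and> (\<forall>\<delta>\<in>hom G T\<^sub>G.
               (\<forall>i\<in>I. \<delta> (word_class I R [(i, True)]) = word_class UNIV R' (a_word i))
               \<longrightarrow> (\<forall>g\<in>carrier G. \<delta> g = \<gamma> g))"
proof -
  define R where "R = r ` J"
  define R' where "R' = subst_word a_word ` R"
  let ?F = "free_group I" and ?G = "presented_group I R" and ?T = "presented_group (UNIV :: xy set) R'"
  have R: "R \<subseteq> words I" and R': "R' \<subseteq> words UNIV" using assms(3) by (auto simp: R_def)
  have I0: "0 \<notin> I" using assms(1) by auto
  define \<phi> where "\<phi> w = word_class UNIV R' (subst_word a_word w)" for w
  have \<phi>_reduce: "\<phi> (reduce w) = \<phi> w" for w
    by (metis \<phi>_def reduce_subst_reduce word_class_reduce)
  have "\<phi> \<in> hom ?F ?T"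
  proof (rule homI)
    show "\<phi> (u \<otimes>\<^bsub>?F\<^esub> v) = \<phi> u \<otimes>\<^bsub>?T\<^esub> \<phi> v" for u v
      by (simp add: free_group_def \<phi>_reduce) (simp add: \<phi>_def subst_word_append word_class_append [OF R'])
  qed (simp add: \<phi>_def word_class_in_presented_group)
  then interpret group_hom ?F ?T \<phi>
    using R' by (simp add: group_hom_def group_hom_axioms_def group_free_group group_presented_group)
  have \<phi>_one: "\<phi> w = \<one>\<^bsub>?T\<^esub> \<longleftrightarrow> reduce (subst_word a_word w) \<in> relator_subgroup UNIV R'" for w
    by (simp add: \<phi>_def word_class_eq_one_iff [OF R'])
  \<comment> \<open>The inclusion \<subseteq> makes the induced map on the quotient injective; the
    converse makes it well defined.\<close>
  have ker: "kernel ?F ?T \<phi> = relator_subgroup I R"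
  proof
    show "kernel ?F ?T \<phi> \<subseteq> relator_subgroup I R"
    proof
      fix w assume "w \<in> kernel ?F ?T \<phi>"
      then have "w \<in> words I" "reduced w" "reduce (subst_word a_word w) \<in> relator_subgroup UNIV (subst_word a_word ` R)"
        by (auto simp: kernel_def \<phi>_one free_group_def simp flip: R'_def)
      then show "w \<in> relator_subgroup I R"
        using subst_a_word_in_relator_subgroup [OF R I0] by fastforce
    qed
    have "reduce ` R \<subseteq> kernel ?F ?T \<phi>"
    proof clarify
      fix w assume "w \<in> R"
      then have "reduce (subst_word a_word w) \<in> relator_subgroup UNIV R'"
        by (auto simp: relator_subgroup_def normal_closure_def R'_def)
      then show "reduce w \<in> kernel ?F ?T \<phi>"
        using R \<open>w \<in> R\<close> by (auto simp: kernel_def \<phi>_one reduce_subst_reduce reduce_in_free_group)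
    qed
    then show "relator_subgroup I R \<subseteq> kernel ?F ?T \<phi>"
      unfolding relator_subgroup_def by (intro normal_closure_subset normal_kernel)
  qed
  \<comment> \<open>\<open>\<phi>\<close> is constant on cosets of its kernel, so each image is a
    singleton.\<close>
  define \<gamma> where "\<gamma> X = the_elem (\<phi> ` X)" for X
  have \<gamma>: "\<gamma> \<in> mon ?G ?T"
    using FactGroup_hom FactGroup_inj_on unfolding ker
    by (simp add: mon_def \<gamma>_def [abs_def] presented_group_def)
  have gen: "\<gamma> (word_class I R [(i, True)]) = word_class UNIV R' (a_word i)" if "i \<in> I" for i
  proof -
    have w: "[(i, True)] \<in> carrier ?F" using that by (simp add: free_group_def reduced_def)
    have "\<phi> ` word_class I R [(i, True)] = {\<phi> [(i, True)]}"
    proof -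
      have "\<phi> v = \<phi> [(i, True)]" if "v \<in> word_class I R [(i, True)]" for v
        using that w by (auto simp: word_class_def r_coset_def kernel_def reduced_def simp flip: ker)
      moreover have "[(i, True)] \<in> word_class I R [(i, True)]"
        using w group.rcos_self [OF group_free_group w, of "relator_subgroup I R"] normal_relator_subgroup [OF R]
        by (simp add: word_class_def normal_def reduced_def)
      ultimately show ?thesis by blast
    qed
    then show ?thesis by (simp add: \<gamma>_def \<phi>_def subst_word_def)
  qed
  have "\<delta> g = \<gamma> g"
    if "\<delta> \<in> hom ?G ?T" "\<forall>i\<in>I. \<delta> (word_class I R [(i, True)]) = word_class UNIV R' (a_word i)" "g \<in> carrier ?G"
    for \<delta> g
    using hom_presented_group_eqI [OF R group_presented_group [OF R'] that(1) _ _ that(3), of \<gamma>] \<gamma> gen that(2)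
    by (simp add: mon_def)
  moreover have "(\<lambda>s. subst_word a_word (r s)) ` J = R'" by (simp add: R'_def R_def image_image)
  ultimately show ?thesis
    unfolding Let_def R_def [symmetric] using \<gamma> gen by (intro exI [of _ \<gamma>]) auto
qed

end
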